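(* Let $\mathbb F$ be a finite field of odd order and let $Q=Q_{a,b}$ be a quadratic quasigroup upon $\mathbb F$ that is not a Netto quasigroup. Let $\mathbb K$, $\mathbb K_0$ and $\mathbb K_1$ be the subfields of $\mathbb F$ generated by $\{a,b\}$, $\{a\}$ and $\{b\}$, respectively. Suppose there exists a $2$-generated subquasigroup of $Q$ that is neither trivial nor minimal. Then the $2$-generated subquasigroups of $Q$ that are neither trivial nor minimal are exactly the sets $\lambda\mathbb K+\mu$ with $\lambda\in\mathbb F^*$, $\mu\in\mathbb F$. Furthermore each of $-1,a,b,1-a,1-b$ is a square in $\mathbb F$, and one of the following holds: (i) every nonzero element of $\mathbb K_1$ is a square in $\mathbb F$ and $\mathbb K_0$ contains a nonsquare; in this case, for $s\in\mathbb K$, $\mathbb K$ is generated as a subquasigroup by $\{0,s\}$ if and only if $\chi(s)=1$ (in particular $\mathbb K$ is generated by $\{0,1\}$), and the minimal subquasigroups of $Q$ are exactly the sets $\zeta\mathbb K_1+\mu$ with $\mu,\zeta\in\mathbb F$, $\chi(\zeta)=-1$; (ii) every nonzero element of $\mathbb K_0$ is a square in $\mathbb F$ and $\mathbb K_1$ contains a nonsquare; in this case, for $\zeta\in\mathbb K$, $\mathbb K$ is generated as a subquasigroup by $\{0,\zeta\}$ if and only if $\chi(\zeta)=-1$, and the minimal subquasigroups of $Q$ are exactly the sets $s\mathbb K_0+\mu$ with $\mu,s\in\mathbb F$, $\chi(s)=1$.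
   Context: $\chi$ is the quadratic character of $\mathbb F$ ($\chi(0)=0$, $1$ on nonzero squares, $-1$ on nonsquares). For $a,b\in\mathbb F$ with $\chi(a)=\chi(b)\ne0$ and $\chi(1-a)=\chi(1-b)\ne0$, $Q_{a,b}$ is $(\mathbb F,* )$ with $x*y=x+a(y-x)$ if $\chi(y-x)\ge0$ and $x*y=x+b(y-x)$ if $\chi(y-x)=-1$. $Q_{a,b}$ is a Netto quasigroup if $\operatorname{char}(\mathbb F)>3$, $a+b=ab=1$ and $\chi(a)=\chi(-1)=-1$. A subquasigroup is trivial if it has at most one element; it is minimal if it is nontrivial and all its proper subquasigroups are trivial; it is $2$-generated if it is the smallest subquasigroup containing some set of at most two elements. *)

theory Defs
  imports "HOL-Computational_Algebra.Nth_Powers" "HOL-Library.Cardinality"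
begin

text \<open>
  Quasigroups and their subquasigroups are subsets of a type, paired with a binary operation on
  that type. The empty set counts as a quasigroup, in line with trivial subquasigroups having
  \<^emph>\<open>at most\<close> one element.
\<close>

definition quasigroup_on :: "'a set \<Rightarrow> ('a \<Rightarrow> 'a \<Rightarrow> 'a) \<Rightarrow> bool" where
  "quasigroup_on S f \<longleftrightarrow>
     (\<forall>x\<in>S. bij_betw (\<lambda>y. f x y) S S) \<and> (\<forall>y\<in>S. bij_betw (\<lambda>x. f x y) S S)"

definition subquasigroup :: "('a \<Rightarrow> 'a \<Rightarrow> 'a) \<Rightarrow> 'a set \<Rightarrow> bool" where
  "subquasigroup f S \<longleftrightarrow> quasigroup_on UNIV f \<and> quasigroup_on S f"

definition trivial_subquasigroup :: "('a \<Rightarrow> 'a \<Rightarrow> 'a) \<Rightarrow> 'a set \<Rightarrow> bool" where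
  "trivial_subquasigroup f S \<longleftrightarrow> subquasigroup f S \<and> finite S \<and> card S \<le> 1"

definition minimal_subquasigroup :: "('a \<Rightarrow> 'a \<Rightarrow> 'a) \<Rightarrow> 'a set \<Rightarrow> bool" where
  "minimal_subquasigroup f S \<longleftrightarrow>
     subquasigroup f S \<and> \<not> trivial_subquasigroup f S \<and>
     (\<forall>T. subquasigroup f T \<and> T \<subset> S \<longrightarrow> trivial_subquasigroup f T)"

definition subquasigroup_generated_by :: "('a \<Rightarrow> 'a \<Rightarrow> 'a) \<Rightarrow> 'a set \<Rightarrow> 'a set \<Rightarrow> bool" where
  "subquasigroup_generated_by f X S \<longleftrightarrow>
     subquasigroup f S \<and> X \<subseteq> S \<and> (\<forall>T. subquasigroup f T \<and> X \<subseteq> T \<longrightarrow> S \<subseteq> T)"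

definition two_generated :: "('a \<Rightarrow> 'a \<Rightarrow> 'a) \<Rightarrow> 'a set \<Rightarrow> bool" where
  "two_generated f S \<longleftrightarrow> (\<exists>X. finite X \<and> card X \<le> 2 \<and> subquasigroup_generated_by f X S)"

definition subfield_set :: "'a::field set \<Rightarrow> bool" where
  "subfield_set K \<longleftrightarrow>
     0 \<in> K \<and> 1 \<in> K \<and>
     (\<forall>x\<in>K. \<forall>y\<in>K. x + y \<in> K \<and> x * y \<in> K) \<and>
     (\<forall>x\<in>K. - x \<in> K \<and> inverse x \<in> K)"

definition subfield_generated :: "'a::field set \<Rightarrow> 'a set" where
  "subfield_generated X = \<Inter>{K. subfield_set K \<and> X \<subseteq> K}"

definition quad_char :: "'a::field \<Rightarrow> int" where
  "quad_char x = (if x = 0 then 0 else if is_square x then 1 else - 1)"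

definition quad_op :: "'a::field \<Rightarrow> 'a \<Rightarrow> 'a \<Rightarrow> 'a \<Rightarrow> 'a" where
  "quad_op a b x y = (if quad_char (y - x) \<ge> 0 then x + a * (y - x) else x + b * (y - x))"

definition is_quadratic_quasigroup :: "'a::field \<Rightarrow> 'a \<Rightarrow> bool" where
  "is_quadratic_quasigroup a b \<longleftrightarrow>
     quad_char a = quad_char b \<and> quad_char b \<noteq> 0 \<and>
     quad_char (1 - a) = quad_char (1 - b) \<and> quad_char (1 - b) \<noteq> 0"

definition is_netto_quasigroup :: "'a::field \<Rightarrow> 'a \<Rightarrow> bool" where
  "is_netto_quasigroup a b \<longleftrightarrow>
     is_quadratic_quasigroup a b \<and> CHAR('a) > 3 \<and> a + b = 1 \<and> a * b = 1 \<and>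
     quad_char a = - 1 \<and> quad_char (- 1 :: 'a) = - 1"

definition affine_image :: "'a::field \<Rightarrow> 'a set \<Rightarrow> 'a \<Rightarrow> 'a set" where
  "affine_image l K m = (\<lambda>x. l * x + m) ` K"

end

theory Submission
  imports Defs
begin

text \<open>
  Affine maps with square linear part are automorphisms of \<open>Q\<^bsub>a,b\<^esub>\<close>, and those with nonsquare
  linear part are isomorphisms onto it from \<open>Q\<^bsub>b,a\<^esub>\<close>. So every subquasigroup generated by two
  points is an affine image of the subquasigroup \<open>S\<close> generated by \<open>0\<close> and \<open>1\<close> in \<open>Q\<^bsub>a,b\<^esub>\<close> or
  in \<open>Q\<^bsub>b,a\<^esub>\<close>, and \<open>S\<close> is invariant under \<open>u \<mapsto> (y - x) u + x\<close> whenever \<open>x, y \<in> S\<close> and \<open>y - x\<close>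
  is a nonzero square. If \<open>S\<close> contains a square other than \<open>0\<close> and \<open>1\<close>, commutators of these maps
  are translations, and enough of them arise to make \<open>S\<close> equal to its translation group \<open>T\<close>; then
  \<open>S\<close> is shown to coincide with the multiplier field of \<open>T\<close>. Otherwise the few products that can
  be computed directly force \<open>a + b = a b = 1\<close>, which is the Netto case or \<open>a = b = -1\<close> in
  characteristic 3. So \<open>S\<close> is the field generated by \<open>a\<close> if that field consists of squares, and the
  field generated by \<open>a\<close> and \<open>b\<close> if not. If the fields generated by \<open>a\<close> and by \<open>b\<close> are alike in
  this respect, all 2-generated nontrivial subquasigroups are minimal; the two mixed cases give
  the two alternatives of the theorem.
\<close>

section \<open>Squares in a finite field\<close>

lemma is_square_iff: "is_square (x :: 'a::monoid_mult) \<longleftrightarrow> (\<exists>y. x = y * y)"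
  by (auto simp: is_nth_power_def power2_eq_square)

lemma is_square_mult_cancel:
  fixes s x :: "'a::field"
  assumes "is_square s" "s \<noteq> 0"
  shows "is_square (s * x) \<longleftrightarrow> is_square x"
proof
  assume "is_square (s * x)"
  then obtain u v where "s * x = u * u" "s = v * v"
    using assms(1) unfolding is_square_iff by blast
  then have "x = (u / v) * (u / v)"
    using assms(2) by (auto simp: field_simps)
  then show "is_square x"
    unfolding is_square_iff by blast
qed (use assms is_nth_power_mult in blast)

text \<open>Squaring maps the nonzero elements onto the nonzero squares with fibres of size at most
  2, so nonsquares are no more numerous than nonzero squares. Multiplication by \<open>z\<close>
  therefore carries \<open>Sq\<close> onto \<open>N\<close>, and \<open>w = z * s\<close> with
  \<open>s\<close> a square gives \<open>z * w = z * z * s\<close>.\<close>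

lemma is_square_mult_nonsquares:
  fixes z w :: "'a::{field,finite}"
  assumes z: "\<not> is_square z" and w: "\<not> is_square w"
  shows "is_square (z * w)"
proof -
  define Sq where "Sq = {x :: 'a. x \<noteq> 0 \<and> is_square x}"
  define N where "N = {x :: 'a. \<not> is_square x}"
  have z0: "z \<noteq> 0"
    using z by (auto simp: is_square_iff)
  have split: "UNIV - {0 :: 'a} = Sq \<union> N" "Sq \<inter> N = {}"
    unfolding Sq_def N_def by (auto simp: is_square_iff)
  have fibre: "card {x :: 'a. x * x = y} \<le> 2" for y
  proof (cases "\<exists>u. u * u = y")
    case True
    then obtain u where "u * u = y" by blast
    then have "{x. x * x = y} \<subseteq> {u, - u}"
      by (auto simp: square_eq_iff)
    then have "card {x. x * x = y} \<le> card {u, - u}"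
      by (intro card_mono) auto
    also have "\<dots> \<le> 2"
      by (simp add: card_insert_if)
    finally show ?thesis .
  qed auto
  have "UNIV - {0 :: 'a} = (\<Union>y\<in>Sq. {x. x * x = y})"
    unfolding Sq_def by (auto simp: is_square_iff)
  then have "card (UNIV - {0 :: 'a}) \<le> (\<Sum>y\<in>Sq. card {x :: 'a. x * x = y})"
    by (simp add: card_UN_le)
  also have "\<dots> \<le> (\<Sum>y\<in>Sq. 2)"
    by (intro sum_mono fibre)
  finally have "card Sq + card N \<le> 2 * card Sq"
    using split by (simp add: card_Un_disjoint mult.commute)
  then have "card N \<le> card ((*) z ` Sq)"
    using z0 by (simp add: card_image inj_on_def)
  moreover have "(*) z ` Sq \<subseteq> N"
  proof
    fix x assume "x \<in> (*) z ` Sq"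
    then obtain s where s: "x = s * z" "s \<in> Sq"
      by (auto simp: mult.commute)
    then show "x \<in> N"
      using z is_square_mult_cancel[of s z] by (auto simp: Sq_def N_def)
  qed
  ultimately have "(*) z ` Sq = N"
    by (intro card_seteq) auto
  then obtain s where "w = z * s" "is_square s"
    using w by (auto simp: N_def Sq_def)
  then show ?thesis
    using is_nth_power_mult[of 2 "z * z" s] by (auto simp: is_square_iff mult.assoc)
qed

lemma is_square_mult_iff:
  fixes x y :: "'a::{field,finite}"
  assumes "x \<noteq> 0" "y \<noteq> 0"
  shows "is_square (x * y) \<longleftrightarrow> (is_square x \<longleftrightarrow> is_square y)"
  using assms is_square_mult_cancel[of x y] is_square_mult_cancel[of y x]
    is_square_mult_nonsquares[of x y] by (auto simp: mult.commute)

lemma is_square_0_1 [simp]: "is_square (0 :: 'a::field)" "is_square (1 :: 'a)"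
  unfolding is_square_iff by (rule exI[of _ 0], simp, rule exI[of _ 1], simp)

lemma quad_char_eq_1_iff: "quad_char x = 1 \<longleftrightarrow> x \<noteq> 0 \<and> is_square x"
  and quad_char_eq_minus_1_iff: "quad_char x = - 1 \<longleftrightarrow> \<not> is_square x"
  by (auto simp: quad_char_def)

text \<open>The predicate \<open>is_square\<close> holds at 0, which matches the convention that a
  zero difference falls on the side of \<open>a\<close>.\<close>

lemma quad_op_eq:
  "quad_op a b x y = (if is_square (y - x) then x + a * (y - x) else x + b * (y - x))"
  by (auto simp: quad_op_def quad_char_def)

lemma is_quadratic_quasigroup_iff:
  "is_quadratic_quasigroup a b \<longleftrightarrow>
     a \<noteq> 0 \<and> b \<noteq> 0 \<and> a \<noteq> 1 \<and> b \<noteq> 1 \<and>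
     (is_square a \<longleftrightarrow> is_square b) \<and> (is_square (1 - a) \<longleftrightarrow> is_square (1 - b))"
  by (auto simp: is_quadratic_quasigroup_def quad_char_def)

section \<open>Subfields of a finite field\<close>

text \<open>Translation by an element of \<open>L\<close> and multiplication by a nonzero one are
  injective maps of a finite set into itself, hence onto; the preimages of 0 and 1 are the two
  inverses.\<close>

lemma subfield_setI:
  fixes L :: "'a::{field,finite} set"
  assumes "0 \<in> L" "1 \<in> L"
    and add: "\<And>x y. x \<in> L \<Longrightarrow> y \<in> L \<Longrightarrow> x + y \<in> L"
    and mult: "\<And>x y. x \<in> L \<Longrightarrow> y \<in> L \<Longrightarrow> x * y \<in> L"
  shows "subfield_set L"
proof -
  have "- x \<in> L" if "x \<in> L" for x
  proof -
    have "(+) x ` L = L"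
      using that add by (intro endo_inj_surj) auto
    then obtain y where "y \<in> L" "0 = x + y"
      using \<open>0 \<in> L\<close> by blast
    then show ?thesis
      by (metis add.inverse_unique)
  qed
  moreover have "inverse x \<in> L" if "x \<in> L" for x
  proof (cases "x = 0")
    case False
    then have "(*) x ` L = L"
      using that mult by (intro endo_inj_surj) (auto simp: inj_on_def)
    then obtain y where "y \<in> L" "1 = x * y"
      using \<open>1 \<in> L\<close> by blast
    then show ?thesis
      by (metis inverse_unique)
  qed (use \<open>0 \<in> L\<close> in simp)
  ultimately show ?thesis
    using assms by (simp add: subfield_set_def)
qed

lemma subfield_set_closed:
  assumes "subfield_set K"
  shows "0 \<in> K" "1 \<in> K"
    and "x \<in> K \<Longrightarrow> y \<in> K \<Longrightarrow> x + y \<in> K"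
    and "x \<in> K \<Longrightarrow> y \<in> K \<Longrightarrow> x * y \<in> K"
    and "x \<in> K \<Longrightarrow> - x \<in> K"
    and "x \<in> K \<Longrightarrow> inverse x \<in> K"
    and "x \<in> K \<Longrightarrow> y \<in> K \<Longrightarrow> x - y \<in> K"
    and "x \<in> K \<Longrightarrow> y \<in> K \<Longrightarrow> x / y \<in> K"
proof -
  note K = assms[unfolded subfield_set_def]
  show "0 \<in> K" "1 \<in> K"
    and "x \<in> K \<Longrightarrow> y \<in> K \<Longrightarrow> x + y \<in> K"
    and "x \<in> K \<Longrightarrow> y \<in> K \<Longrightarrow> x * y \<in> K"
    and "x \<in> K \<Longrightarrow> - x \<in> K"
    and "x \<in> K \<Longrightarrow> inverse x \<in> K"
    using K by blast+
  show "x \<in> K \<Longrightarrow> y \<in> K \<Longrightarrow> x - y \<in> K"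
    using K by (metis diff_conv_add_uminus)
  show "x \<in> K \<Longrightarrow> y \<in> K \<Longrightarrow> x / y \<in> K"
    using K by (metis divide_inverse)
qed

lemma subfield_set_subfield_generated: "subfield_set (subfield_generated X)"
  unfolding subfield_generated_def subfield_set_def[of "\<Inter>_"]
  by (auto simp: subfield_set_closed)

lemma subfield_generated_superset: "X \<subseteq> subfield_generated X"
  unfolding subfield_generated_def by blast

lemma subfield_generated_least: "subfield_set K \<Longrightarrow> X \<subseteq> K \<Longrightarrow> subfield_generated X \<subseteq> K"
  unfolding subfield_generated_def by blast

text \<open>An affine line over \<open>K\<close> is determined by any two of its points: their
  coordinates satisfy \<open>v - u \<noteq> 0\<close>, so \<open>k \<mapsto> (v - u) * k + u\<close>
  permutes \<open>K\<close>.\<close>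

lemma affine_image_rebase:
  assumes K: "subfield_set K" and x: "x \<in> affine_image l K m" and y: "y \<in> affine_image l K m"
    and "x \<noteq> y"
  shows "affine_image (y - x) K x = affine_image l K m"
proof -
  obtain u v where u: "u \<in> K" "x = l * u + m" and v: "v \<in> K" "y = l * v + m"
    using x y unfolding affine_image_def by blast
  have uv: "v - u \<noteq> 0"
    using \<open>x \<noteq> y\<close> u v by auto
  have "(y - x) * k + x = l * ((v - u) * k + u) + m" for k
    using u v by (simp add: algebra_simps)
  moreover have "l * k + m = (y - x) * ((k - u) / (v - u)) + x" for k
  proof -
    have "(y - x) * ((k - u) / (v - u)) = l * ((v - u) * ((k - u) / (v - u)))"
      using u v by (simp add: algebra_simps)
    also have "(v - u) * ((k - u) / (v - u)) = k - u"
      using uv by simp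
    finally show ?thesis
      using u by (simp add: algebra_simps)
  qed
  moreover have "(v - u) * k + u \<in> K" "(k - u) / (v - u) \<in> K" if "k \<in> K" for k
    using u(1) v(1) that by (auto intro!: subfield_set_closed[OF K])
  ultimately show ?thesis
    unfolding affine_image_def by (intro antisym image_subsetI) (metis imageI)+
qed

section \<open>Closed sets and generated subquasigroups\<close>

definition op_closed :: "('a \<Rightarrow> 'a \<Rightarrow> 'a) \<Rightarrow> 'a set \<Rightarrow> bool" where
  "op_closed f S \<longleftrightarrow> (\<forall>x\<in>S. \<forall>y\<in>S. f x y \<in> S)"

text \<open>Closure is asked for under the operation only, not under the divisions; on a finite
  quasigroup the hull is still the generated subquasigroup.\<close>

definition op_hull :: "('a \<Rightarrow> 'a \<Rightarrow> 'a) \<Rightarrow> 'a set \<Rightarrow> 'a set" where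
  "op_hull f X = \<Inter>{S. op_closed f S \<and> X \<subseteq> S}"

lemma op_closed_op_hull: "op_closed f (op_hull f X)"
  unfolding op_closed_def op_hull_def by blast

lemma op_hull_superset: "X \<subseteq> op_hull f X"
  unfolding op_hull_def by blast

lemma op_hull_least: "op_closed f S \<Longrightarrow> X \<subseteq> S \<Longrightarrow> op_hull f X \<subseteq> S"
  unfolding op_hull_def by blast

text \<open>Both the image and the preimage of a closed set under the homomorphism \<open>h\<close>
  are closed; each gives one inclusion.\<close>

lemma op_hull_image:
  assumes hom: "\<And>x y. f (h x) (h y) = h (g x y)"
  shows "op_hull f (h ` X) = h ` op_hull g X"
proof (rule antisym)
  have "op_closed f (h ` op_hull g X)"
    using op_closed_op_hull[of g X] by (auto simp: op_closed_def hom)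
  then show "op_hull f (h ` X) \<subseteq> h ` op_hull g X"
    by (intro op_hull_least image_mono op_hull_superset)
  have "op_closed g (h -` op_hull f (h ` X))"
    using op_closed_op_hull[of f "h ` X"] by (auto simp: op_closed_def simp flip: hom)
  then have "op_hull g X \<subseteq> h -` op_hull f (h ` X)"
    using op_hull_superset[of "h ` X" f] by (intro op_hull_least) auto
  then show "h ` op_hull g X \<subseteq> op_hull f (h ` X)"
    by blast
qed

text \<open>The map \<open>h\<close> sends 0 and 1 to \<open>x\<close> and \<open>y\<close>. It
  multiplies differences by \<open>y - x\<close>, which keeps the roles of \<open>a\<close> and
  \<open>b\<close> if this is a square and swaps them otherwise.\<close>

lemma op_hull_quad_op:
  fixes a b :: "'a::{field,finite}"
  assumes "x \<noteq> y"
  shows "op_hull (quad_op a b) {x, y} =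
    affine_image (y - x)
      (op_hull (if is_square (y - x) then quad_op a b else quad_op b a) {0, 1}) x"
proof -
  define h where "h = (\<lambda>t. (y - x) * t + x)"
  have "quad_op a b (h u) (h v) =
      h ((if is_square (y - x) then quad_op a b else quad_op b a) u v)" for u v
  proof -
    have "h v - h u = (y - x) * (v - u)"
      by (simp add: h_def algebra_simps)
    moreover have "is_square ((y - x) * (v - u)) \<longleftrightarrow>
        (is_square (y - x) \<longleftrightarrow> is_square (v - u))" if "u \<noteq> v"
      using assms that by (intro is_square_mult_iff) auto
    ultimately show ?thesis
      by (cases "u = v") (auto simp: quad_op_eq h_def algebra_simps)
  qed
  then show ?thesis
    using op_hull_image[of "quad_op a b" h _ "{0, 1}"] by (simp add: affine_image_def h_def)
qed

text \<open>If \<open>K\<close> consists of squares, the branch with \<open>b\<close> is never taken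
  on \<open>K\<close>.\<close>

lemma op_closed_quad_op:
  assumes K: "subfield_set K" and "a \<in> K" and "b \<in> K \<or> (\<forall>x\<in>K. is_square x)"
  shows "op_closed (quad_op a b) K"
  unfolding op_closed_def
proof (intro ballI)
  fix x y assume xy: "x \<in> K" "y \<in> K"
  have "y - x \<in> K"
    using xy by (intro subfield_set_closed[OF K])
  then show "quad_op a b x y \<in> K"
    using assms(2,3) xy unfolding quad_op_eq by (auto intro!: subfield_set_closed(3,4)[OF K])
qed

section \<open>Subquasigroups of a finite quasigroup as closed sets\<close>

lemma subquasigroup_iff:
  fixes f :: "'a::finite \<Rightarrow> 'a \<Rightarrow> 'a"
  assumes "quasigroup_on UNIV f"
  shows "subquasigroup f S \<longleftrightarrow> op_closed f S"
proof
  assume "subquasigroup f S"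
  then show "op_closed f S"
    unfolding subquasigroup_def quasigroup_on_def op_closed_def by (meson bij_betwE)
next
  assume S: "op_closed f S"
  \<comment> \<open>Finiteness: an injective translation that maps \<open>S\<close> into itself is
    onto \<open>S\<close>, so solvability of equations comes for free.\<close>
  have "bij_betw g S S" if "bij_betw g UNIV UNIV" "g ` S \<subseteq> S" for g
  proof -
    have "inj_on g S"
      using that(1) by (meson bij_betw_def inj_on_subset subset_UNIV)
    then show ?thesis
      using that(2) by (simp add: bij_betw_def endo_inj_surj)
  qed
  then have "quasigroup_on S f"
    using assms S unfolding quasigroup_on_def op_closed_def
    by (metis UNIV_I image_subsetI)
  then show "subquasigroup f S"
    using assms by (simp add: subquasigroup_def)
qed

lemma subquasigroup_generated_by_iff:
  fixes f :: "'a::finite \<Rightarrow> 'a \<Rightarrow> 'a"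
  assumes "quasigroup_on UNIV f"
  shows "subquasigroup_generated_by f X S \<longleftrightarrow> S = op_hull f X"
  unfolding subquasigroup_generated_by_def subquasigroup_iff[OF assms]
  using op_closed_op_hull[of f X] op_hull_superset[of X f] op_hull_least[of f _ X]
  by (auto intro: antisym)

lemma card_le_1_iff:
  fixes S :: "'a::finite set"
  shows "card S \<le> 1 \<longleftrightarrow> (\<forall>x\<in>S. \<forall>y\<in>S. x = y)"
  by (simp add: card_le_Suc0_iff_eq)

lemma trivial_subquasigroup_iff:
  fixes f :: "'a::finite \<Rightarrow> 'a \<Rightarrow> 'a"
  assumes "quasigroup_on UNIV f"
  shows "trivial_subquasigroup f S \<longleftrightarrow> op_closed f S \<and> (\<forall>x\<in>S. \<forall>y\<in>S. x = y)"
  by (simp add: trivial_subquasigroup_def subquasigroup_iff[OF assms] card_le_1_iff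
      card_le_Suc0_iff_eq)

text \<open>Two distinct points generate a nontrivial subquasigroup, which cannot be proper in a
  minimal one. Conversely, a nontrivial closed subset contains two distinct points and so all of
  \<open>S\<close>.\<close>

lemma minimal_subquasigroup_iff:
  fixes f :: "'a::finite \<Rightarrow> 'a \<Rightarrow> 'a"
  assumes Q: "quasigroup_on UNIV f"
  shows "minimal_subquasigroup f S \<longleftrightarrow>
    (\<exists>x\<in>S. \<exists>y\<in>S. x \<noteq> y) \<and> (\<forall>x\<in>S. \<forall>y\<in>S. x \<noteq> y \<longrightarrow> op_hull f {x, y} = S)"
    (is "_ \<longleftrightarrow> ?R")
proof
  assume S: "minimal_subquasigroup f S"
  then have cl: "op_closed f S"
    by (simp add: minimal_subquasigroup_def subquasigroup_iff[OF Q])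
  have "op_hull f {x, y} = S" if "x \<in> S" "y \<in> S" "x \<noteq> y" for x y
  proof (rule ccontr)
    assume "op_hull f {x, y} \<noteq> S"
    moreover have "op_hull f {x, y} \<subseteq> S"
      using cl that by (intro op_hull_least) auto
    ultimately have "trivial_subquasigroup f (op_hull f {x, y})"
      using S op_closed_op_hull[of f "{x, y}"]
      by (auto simp: minimal_subquasigroup_def subquasigroup_iff[OF Q])
    then show False
      using op_hull_superset[of "{x, y}" f] \<open>x \<noteq> y\<close>
      by (auto simp: trivial_subquasigroup_iff[OF Q])
  qed
  then show ?R
    using S cl by (auto simp: minimal_subquasigroup_def trivial_subquasigroup_iff[OF Q])
next
  assume R: ?R
  then have "op_closed f S"
    using op_closed_op_hull by metis
  moreover have "trivial_subquasigroup f T" if T: "op_closed f T" "T \<subset> S" for T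
  proof (rule ccontr)
    assume "\<not> trivial_subquasigroup f T"
    then obtain x y where xy: "x \<in> T" "y \<in> T" "x \<noteq> y"
      using T(1) by (auto simp: trivial_subquasigroup_iff[OF Q])
    then have "op_hull f {x, y} \<subseteq> T"
      using T(1) by (intro op_hull_least) auto
    moreover have "op_hull f {x, y} = S"
      using R xy T(2) by auto
    ultimately show False
      using T(2) by blast
  qed
  ultimately show "minimal_subquasigroup f S"
    using R by (auto simp: minimal_subquasigroup_def trivial_subquasigroup_iff[OF Q]
        subquasigroup_iff[OF Q])
qed

text \<open>By idempotence a set with at most one element is closed and generates only itself, so a
  nontrivial hull needs two distinct generators.\<close>

lemma nontrivial_two_generated_iff:
  fixes f :: "'a::finite \<Rightarrow> 'a \<Rightarrow> 'a"
  assumes Q: "quasigroup_on UNIV f" and idem: "\<And>x. f x x = x"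
  shows "two_generated f S \<and> \<not> trivial_subquasigroup f S \<longleftrightarrow>
    (\<exists>x y. x \<noteq> y \<and> S = op_hull f {x, y})" (is "?L \<longleftrightarrow> ?R")
proof
  assume L: ?L
  then obtain X where X: "card X \<le> 2" "S = op_hull f X"
    by (auto simp: two_generated_def subquasigroup_generated_by_iff[OF Q])
  have "\<not> (\<forall>x\<in>X. \<forall>y\<in>X. x = y)"
  proof
    assume *: "\<forall>x\<in>X. \<forall>y\<in>X. x = y"
    then have "op_closed f X"
      using idem by (metis op_closed_def)
    then have "S = X"
      using X(2) op_hull_superset[of X f] op_hull_least[of f X X] by auto
    then show False
      using L * \<open>op_closed f X\<close> by (simp add: trivial_subquasigroup_iff[OF Q])
  qed
  then have "card X = 2"
    using X(1) card_le_1_iff[of X] by linarith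
  then show ?R
    using X(2) by (auto simp: card_2_iff)
next
  assume ?R
  then obtain x y where xy: "x \<noteq> y" "S = op_hull f {x, y}" by blast
  then have "two_generated f S"
    unfolding two_generated_def subquasigroup_generated_by_iff[OF Q]
    by (intro exI[of _ "{x, y}"]) auto
  then show ?L
    using xy op_hull_superset[of "{x, y}" f] by (auto simp: trivial_subquasigroup_iff[OF Q])
qed

section \<open>The subquasigroup generated by 0 and 1\<close>

text \<open>The square \<open>s\<close> gives a scaling of \<open>S\<close> whose commutators with
  other affine maps of \<open>S\<close> are translations. The claim reduces to
  \<open>S = T = L\<close>, with \<open>T\<close> the translations preserving \<open>S\<close> and
  \<open>L\<close> the field of multipliers of \<open>T\<close>.\<close>

lemma subfield_set_op_hull_of_square:
  fixes a b s :: "'a::{field,finite}"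
  defines "S \<equiv> op_hull (quad_op a b) {0, 1}"
  assumes ab: "is_quadratic_quasigroup a b"
    and s: "s \<in> S" "is_square s" "s \<noteq> 0" "s \<noteq> 1"
  shows "subfield_set S"
proof -
  note ab' = ab[unfolded is_quadratic_quasigroup_iff]
  have S01: "0 \<in> S" "1 \<in> S"
    using op_hull_superset[of "{0, 1}" "quad_op a b"] unfolding S_def by auto
  have opS: "quad_op a b x y \<in> S" if "x \<in> S" "y \<in> S" for x y
    using op_closed_op_hull[of "quad_op a b" "{0, 1}"] that unfolding S_def op_closed_def by blast
  have aS: "a \<in> S"
    using opS[OF S01] by (simp add: quad_op_eq)
  have aff: "(y - x) * u + x \<in> S"
    if "x \<in> S" "y \<in> S" "x \<noteq> y" "is_square (y - x)" "u \<in> S" for x y u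
  proof -
    have "op_hull (quad_op a b) {x, y} \<subseteq> S"
      using that op_closed_op_hull[of "quad_op a b" "{0, 1}"] unfolding S_def by (intro op_hull_least) auto
    then show ?thesis
      using that by (auto simp: op_hull_quad_op affine_image_def simp flip: S_def)
  qed
  have mulS: "p * u \<in> S" if "p \<in> S" "is_square p" "u \<in> S" for p u
    using aff[of 0 p u] that S01 by (cases "p = 0") auto
  \<comment> \<open>On the finite set \<open>S\<close> this replaces passing to the inverse of an
    affine map.\<close>
  have affine_onto: "\<exists>v\<in>S. u = r * v + x"
    if "r \<noteq> 0" "u \<in> S" "\<And>v. v \<in> S \<Longrightarrow> r * v + x \<in> S" for r x u
  proof -
    have "(\<lambda>v. r * v + x) ` S = S"
      using that by (intro endo_inj_surj) (auto simp: inj_on_def)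
    then show ?thesis
      using \<open>u \<in> S\<close> by blast
  qed

  define T where "T = {t. \<forall>u\<in>S. u + t \<in> S}"
  define L where "L = {l. \<forall>t\<in>T. l * t \<in> T}"
  have T_add: "t + t' \<in> T" if "t \<in> T" "t' \<in> T" for t t'
    using that by (auto simp: T_def simp flip: add.assoc)
  have "0 \<in> T"
    by (simp add: T_def)
  have L: "subfield_set L"
    by (rule subfield_setI) (auto simp: L_def \<open>0 \<in> T\<close> distrib_right mult.assoc T_add)
  note L_cl = subfield_set_closed[OF L]
  have "T \<subseteq> S"
    using S01 by (force simp: T_def)
  \<comment> \<open>Conjugating the translation by \<open>t\<close> with multiplication by
    \<open>p\<close> gives the translation by \<open>p * t\<close>.\<close>
  have square_in_L: "p \<in> L" if p: "p \<in> S" "is_square p" for p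
  proof (cases "p = 0")
    case False
    have "u + p * t \<in> S" if "t \<in> T" "u \<in> S" for t u
    proof -
      obtain v where "v \<in> S" "u = p * v"
        using affine_onto[of p u 0] False mulS p \<open>u \<in> S\<close> by auto
      moreover have "p * (v + t) \<in> S"
        using mulS[OF p] \<open>t \<in> T\<close> \<open>v \<in> S\<close> by (auto simp: T_def)
      ultimately show ?thesis
        by (simp add: distrib_left)
    qed
    then show ?thesis
      by (auto simp: L_def T_def)
  qed (use L_cl(1) in simp)

  \<comment> \<open>The affine maps \<open>u \<mapsto> s * (r * u + x)\<close> and \<open>u \<mapsto> s * r * u + x\<close> preserve \<open>S\<close> and have the
    same linear part, so their quotient is the translation by \<open>(s - 1) * x\<close>.\<close>
  have in_T: "x \<in> T" if xy: "x \<in> S" "y \<in> S" "x \<noteq> y" "is_square (y - x)" for x y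
  proof -
    define r where "r = y - x"
    have r: "r \<noteq> 0" "\<And>v. v \<in> S \<Longrightarrow> r * v + x \<in> S"
      using xy aff by (auto simp: r_def)
    have "u + (s - 1) * x \<in> S" if "u \<in> S" for u
    proof -
      have "s * r * v + x \<in> S" if "v \<in> S" for v
        using r(2)[of "s * v"] mulS[of s v] s that by (simp add: mult_ac)
      then obtain v where v: "v \<in> S" "u = s * r * v + x"
        using affine_onto[of "s * r" u x] r(1) s(3) \<open>u \<in> S\<close> by auto
      have "s * (r * v + x) \<in> S"
        using mulS[of s] s r(2) v(1) by blast
      then show ?thesis
        using v(2) by (simp add: algebra_simps)
    qed
    then have "(s - 1) * x \<in> T"
      by (simp add: T_def)
    \<comment> \<open>The factor \<open>s - 1\<close> can be cancelled, because \<open>s\<close>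
      lies in \<open>L\<close> and \<open>L\<close> is a field.\<close>
    moreover have "inverse (s - 1) \<in> L"
      using square_in_L[OF s(1,2)] by (auto intro!: L_cl(2,6,7))
    ultimately have "inverse (s - 1) * ((s - 1) * x) \<in> T"
      by (simp add: L_def)
    then show ?thesis
      using \<open>s \<noteq> 1\<close> by (simp flip: mult.assoc)
  qed

  have minus: "is_square (- x) \<longleftrightarrow> \<not> is_square x" if "\<not> is_square (- 1 :: 'a)" "x \<noteq> 0" for x :: 'a
    using is_square_mult_iff[of "- 1" x] that by auto
  have "1 \<in> T"
  proof (cases "is_square (- 1 :: 'a)")
    case True
    then show ?thesis
      using in_T[of 1 0] S01 by simp
  next
    case False
    \<comment> \<open>Since \<open>- 1\<close> is a nonsquare and \<open>a \<noteq> 1\<close>, one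
      of the two differences between 1 and \<open>a\<close> is a square.\<close>
    consider "is_square (a - 1)" | "is_square (1 - a)"
      using minus[OF False, of "a - 1"] ab' by auto
    then show ?thesis
    proof cases
      case 1
      then show ?thesis
        using in_T[of 1 a] S01 aS ab' by auto
    next
      case 2
      then have "a \<in> T"
        using in_T[of a 1] S01 aS ab' by auto
      moreover have "- 1 \<in> L"
        by (intro L_cl(2,5))
      ultimately have "- a \<in> T"
        by (force simp: L_def)
      \<comment> \<open>These points differ from 1 by \<open>a\<close> and \<open>- a\<close>, one
        of which is a square, so \<open>in_T\<close> applies to 1 with one of them.\<close>
      then have "1 + a \<in> S" "1 - a \<in> S"
        using \<open>a \<in> T\<close> S01 by (auto simp: T_def dest!: bspec[of S _ 1])
      then show ?thesis
        using in_T[of 1 "1 + a"] in_T[of 1 "1 - a"] minus[OF False, of a] S01 ab' by auto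
    qed
  qed
  \<comment> \<open>The points \<open>x\<close> and \<open>x + 1\<close> both lie in
    \<open>S\<close> and differ by the square 1.\<close>
  have "S \<subseteq> T"
  proof
    fix x assume "x \<in> S"
    moreover from this have "x + 1 \<in> S"
      using \<open>1 \<in> T\<close> by (simp add: T_def)
    ultimately show "x \<in> T"
      using in_T[of x "x + 1"] by simp
  qed
  then have ST: "S = T"
    using \<open>T \<subseteq> S\<close> by blast
  have "L \<subseteq> S"
    using \<open>1 \<in> T\<close> ST by (force simp: L_def)
  have LS: "l * x \<in> S" if "l \<in> L" "x \<in> S" for l x
    using that ST by (simp add: L_def)

  have "S \<subseteq> L"
  proof (rule ccontr)
    assume "\<not> S \<subseteq> L"
    then obtain z where z: "z \<in> S" "z \<notin> L" by blast
    \<comment> \<open>The element \<open>z\<close> is a nonsquare, as squares of \<open>S\<close>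
      lie in \<open>L\<close>. A nonsquare \<open>l\<close> in \<open>L\<close> would make
      \<open>l * z\<close> a square of \<open>S\<close>, hence an element of \<open>L\<close>, and
      dividing by \<open>l\<close> would put \<open>z\<close> in \<open>L\<close>.\<close>
    have Lsq: "is_square l" if "l \<in> L" for l
    proof (rule ccontr)
      assume l: "\<not> is_square l"
      then have "l \<noteq> 0"
        by auto
      have "l * z \<in> L"
        using LS[OF that z(1)] square_in_L is_square_mult_nonsquares[OF l] z by blast
      then have "l * z / l \<in> L"
        using L_cl(8) that by blast
      then show False
        using \<open>l \<noteq> 0\<close> z by simp
    qed
    show False
    proof (cases "is_square a")
      case True
      then have "a \<in> L"
        using square_in_L aS by blast
      then have "op_closed (quad_op a b) L"
        using op_closed_quad_op[OF L] Lsq by blast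
      then have "S \<subseteq> L"
        unfolding S_def using L_cl(1,2) by (intro op_hull_least) auto
      then show False
        using z by blast
    next
      case False
      then have b: "\<not> is_square b"
        using ab' by blast
      have nsq: "\<not> is_square x" if "x \<in> S" "x \<notin> L" for x
        using square_in_L that by blast
      have bx: "b * x \<in> S" if "x \<in> S" "\<not> is_square x" for x
        using opS[of 0 x] S01 that by (simp add: quad_op_eq)
      have "a \<notin> L"
        using Lsq False by blast
      have "a + 1 \<notin> L"
        using L_cl(7)[of "a + 1" 1] L_cl(2) \<open>a \<notin> L\<close> by auto
      have "a + 1 \<in> S"
        using aS \<open>1 \<in> T\<close> by (simp add: T_def)
      \<comment> \<open>A product of two nonsquares lies in \<open>L\<close> as soon as it lies in
        \<open>S\<close>. Subtracting \<open>b * a\<close> from \<open>b * (a + 1)\<close> gives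
        \<open>b \<in> S\<close>; then \<open>b * b\<close> and hence \<open>a * a\<close> lie in
        \<open>L\<close>. Thus \<open>a * (a + 1)\<close> is in \<open>S\<close> but outside
        \<open>L\<close>, yet it is a product of two nonsquares.\<close>
      have ba: "b * a \<in> L"
        using bx aS False is_square_mult_nonsquares[OF b False] square_in_L by blast
      then have "- (b * a) \<in> T"
        using L_cl(5) \<open>L \<subseteq> S\<close> ST by blast
      moreover have "b * (a + 1) \<in> S"
        using bx nsq \<open>a + 1 \<in> S\<close> \<open>a + 1 \<notin> L\<close> by blast
      ultimately have "b * (a + 1) + - (b * a) \<in> S"
        by (simp add: T_def)
      then have "b \<in> S"
        by (simp add: algebra_simps)
      then have bb: "b * b \<in> L"
        using bx b is_square_mult_nonsquares[OF b b] square_in_L by blast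
      have "(b * a) * (b * a) / (b * b) \<in> L"
        by (rule L_cl(8)[OF L_cl(4)[OF ba ba] bb])
      then have aa: "a * a \<in> L"
        using ab' by (simp add: field_simps)
      have "a * (a + 1) \<notin> L"
        using L_cl(7)[of "a * (a + 1)" "a * a"] aa \<open>a \<notin> L\<close> by (auto simp: algebra_simps)
      moreover have "a * a \<in> T"
        using aa \<open>L \<subseteq> S\<close> ST by blast
      then have "a * (a + 1) \<in> S"
        using aS by (auto simp: T_def algebra_simps)
      ultimately have "\<not> is_square (a * (a + 1))"
        using nsq by blast
      then show False
        using is_square_mult_nonsquares[OF False] nsq \<open>a + 1 \<in> S\<close> \<open>a + 1 \<notin> L\<close> by blast
    qed
  qed
  then show ?thesis
    using L \<open>L \<subseteq> S\<close> by (simp add: subset_antisym)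
qed

text \<open>What remains is the case where 0 and 1 are the only squares in \<open>S\<close>. Every
  product of two nonsquares that lies in \<open>S\<close> is then 1, which yields
  \<open>a + b = a * b = 1\<close> and leaves only characteristic 3, where \<open>S\<close> is the
  prime field.\<close>

lemma subfield_set_op_hull:
  fixes a b :: "'a::finite_field"
  assumes ab: "is_quadratic_quasigroup a b" and netto: "\<not> is_netto_quasigroup a b"
  shows "subfield_set (op_hull (quad_op a b) {0, 1})"
proof -
  define S where "S = op_hull (quad_op a b) {0, 1}"
  note ab' = ab[unfolded is_quadratic_quasigroup_iff]
  have S01: "0 \<in> S" "1 \<in> S"
    using op_hull_superset[of "{0, 1}" "quad_op a b"] unfolding S_def by auto
  have opS: "quad_op a b x y \<in> S" if "x \<in> S" "y \<in> S" for x y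
    using op_closed_op_hull[of "quad_op a b" "{0, 1}"] that unfolding S_def op_closed_def by blast
  have aS: "a \<in> S"
    using opS[OF S01] by (simp add: quad_op_eq)
  show ?thesis
  proof (cases "\<exists>s\<in>S. is_square s \<and> s \<noteq> 0 \<and> s \<noteq> 1")
    case True
    then show ?thesis
      using subfield_set_op_hull_of_square[OF ab] unfolding S_def by blast
  next
    case False
    then have only1: "x = 1" if "x \<in> S" "is_square x" "x \<noteq> 0" for x
      using that by blast
    have bx: "b * x \<in> S" if "x \<in> S" "\<not> is_square x" for x
      using opS[of 0 x] S01 that by (simp add: quad_op_eq)
    have a: "\<not> is_square a"
      using only1[OF aS] ab' by auto
    then have b: "\<not> is_square b"
      using ab' by blast
    have ba: "b * a = 1"
      using only1[of "b * a"] bx aS a is_square_mult_nonsquares[OF b a] ab' by auto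
    \<comment> \<open>If \<open>- 1\<close> were a square, \<open>b * (1 - a) = 1\<close> and
      \<open>b * a = 1\<close> would give \<open>1 - b = - 1\<close>, a square, whereas
      \<open>1 - a\<close> is a nonsquare.\<close>
    have m1: "\<not> is_square (- 1 :: 'a)"
    proof
      assume sq1: "is_square (- 1 :: 'a)"
      then have S: "1 - a \<in> S"
        using opS[of 1 0] S01 by (simp add: quad_op_eq)
      then have nsq: "\<not> is_square (1 - a)"
        using only1[of "1 - a"] ab' by auto
      have "b * (1 - a) = 1"
        using only1[of "b * (1 - a)"] bx[OF S nsq] is_square_mult_nonsquares[OF b nsq] ab' by auto
      then have "1 - b = - 1"
        using ba by (simp add: algebra_simps)
      then show False
        using sq1 nsq ab' by metis
    qed
    then have S: "1 - b \<in> S"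
      using opS[of 1 0] S01 by (simp add: quad_op_eq)
    then have nsq: "\<not> is_square (1 - b)"
      using only1[of "1 - b"] ab' by auto
    have bb: "b * (1 - b) = 1"
      using only1[of "b * (1 - b)"] bx[OF S nsq] is_square_mult_nonsquares[OF b nsq] ab' by auto
    then have "a = 1 - b"
      using ba ab' by (metis mult_left_cancel)
    then have "\<not> CHAR('a) > 3"
      using netto ab a m1 ba
      by (simp add: is_netto_quasigroup_def quad_char_eq_minus_1_iff mult.commute)
    moreover have "CHAR('a) \<noteq> 2"
    proof
      assume "CHAR('a) = 2"
      then have "(1 :: 'a) + 1 = 0"
        by (metis of_nat_CHAR of_nat_numeral one_add_one)
      then have "(- 1 :: 'a) = 1"
        by (rule minus_unique)
      then show False
        using m1 by (metis is_square_0_1(2))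
    qed
    moreover have "CHAR('a) \<ge> 2"
      using prime_ge_2_nat CHAR_prime by blast
    ultimately have "CHAR('a) = 3"
      by linarith
    then have three: "(3 :: 'a) = 0"
      by (metis of_nat_CHAR of_nat_numeral)
    \<comment> \<open>In characteristic 3 the equation \<open>b * (1 - b) = 1\<close> has the double
      root \<open>- 1\<close>.\<close>
    have "(b + 1) * (b + 1) = 1 - b * (1 - b) + 3 * b"
      by (simp add: algebra_simps)
    then have "b = - 1"
      using bb three by (simp add: eq_neg_iff_add_eq_0)
    moreover have two: "(2 :: 'a) = - 1"
      using three by (simp add: eq_neg_iff_add_eq_0)
    ultimately have "a = - 1"
      using \<open>a = 1 - b\<close> by simp
    define P where "P = {0, 1, - 1 :: 'a}"
    have "subfield_set P"
      by (rule subfield_setI) (auto simp: P_def two)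
    moreover have "S = P"
    proof
      have "op_closed (quad_op a b) P"
        by (auto simp: P_def op_closed_def quad_op_eq \<open>a = - 1\<close> \<open>b = - 1\<close> two)
      then show "S \<subseteq> P"
        unfolding S_def by (intro op_hull_least) (auto simp: P_def)
      show "P \<subseteq> S"
        using S01 aS \<open>a = - 1\<close> by (simp add: P_def)
    qed
    ultimately show ?thesis
      by (simp add: S_def)
  qed
qed

text \<open>The hull is a field containing \<open>a\<close>. A nonsquare \<open>z\<close> in the
  field generated by \<open>a\<close> brings in \<open>b * z\<close>, the product of 0 and
  \<open>z\<close>, and hence \<open>b\<close>; without such a \<open>z\<close> that field is
  already closed.\<close>

lemma op_hull_eq_subfield_generated:
  fixes a b :: "'a::finite_field"
  assumes "is_quadratic_quasigroup a b" "\<not> is_netto_quasigroup a b"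
  shows "op_hull (quad_op a b) {0, 1} =
    (if \<forall>x\<in>subfield_generated {a}. is_square x
     then subfield_generated {a} else subfield_generated {a, b})"
proof -
  define S where "S = op_hull (quad_op a b) {0, 1}"
  have S: "subfield_set S"
    unfolding S_def by (rule subfield_set_op_hull[OF assms])
  note S_cl = subfield_set_closed[OF S]
  have opS: "quad_op a b x y \<in> S" if "x \<in> S" "y \<in> S" for x y
    using op_closed_op_hull[of "quad_op a b" "{0, 1}"] that unfolding S_def op_closed_def by blast
  have "a \<in> S"
    using opS[of 0 1] S_cl(1,2) by (simp add: quad_op_eq)
  then have K0: "subfield_generated {a} \<subseteq> S"
    using S by (intro subfield_generated_least) auto
  have least: "S \<subseteq> M" if "subfield_set M" "op_closed (quad_op a b) M" for M
    unfolding S_def using that subfield_set_closed(1,2)[of M] by (intro op_hull_least) auto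
  show ?thesis
  proof (cases "\<forall>x\<in>subfield_generated {a}. is_square x")
    case True
    have "a \<in> subfield_generated {a}"
      using subfield_generated_superset by blast
    then have "op_closed (quad_op a b) (subfield_generated {a})"
      using True op_closed_quad_op[OF subfield_set_subfield_generated] by blast
    then have "S = subfield_generated {a}"
      using K0 least subfield_set_subfield_generated by blast
    then show ?thesis
      using True S_def by simp
  next
    case False
    then obtain z where z: "z \<in> S" "\<not> is_square z"
      using K0 by blast
    then have "b * z \<in> S"
      using opS[of 0 z] S_cl(1) by (simp add: quad_op_eq)
    then have "b * z / z \<in> S"
      using z(1) by (rule S_cl(8))
    moreover have "z \<noteq> 0"
      using z by auto
    ultimately have "b \<in> S"
      by simp
    then have "subfield_generated {a, b} \<subseteq> S"
      using S \<open>a \<in> S\<close> by (intro subfield_generated_least) auto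
    moreover have "a \<in> subfield_generated {a, b}" "b \<in> subfield_generated {a, b}"
      using subfield_generated_superset by blast+
    then have "op_closed (quad_op a b) (subfield_generated {a, b})"
      using op_closed_quad_op[OF subfield_set_subfield_generated] by blast
    ultimately have "S = subfield_generated {a, b}"
      using least subfield_set_subfield_generated by blast
    then show ?thesis
      using False S_def by auto
  qed
qed

section \<open>Quasigroups with two classes of lines\<close>

lemma quad_char_mult:
  fixes x y :: "'a::{field,finite}"
  shows "quad_char (x * y) = quad_char x * quad_char y"
  using is_square_mult_iff[of x y] by (auto simp: quad_char_def)

lemma card_affine_image: "l \<noteq> 0 \<Longrightarrow> card (affine_image l K m) = card K"
  unfolding affine_image_def by (rule card_image) (simp add: inj_on_def)

lemma affine_image_diff:
  assumes K: "subfield_set K" and "x \<in> affine_image l K m" "y \<in> affine_image l K m"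
  obtains k where "k \<in> K" "y - x = l * k"
proof -
  obtain u v where "u \<in> K" "x = l * u + m" "v \<in> K" "y = l * v + m"
    using assms(2,3) unfolding affine_image_def by blast
  then have "v - u \<in> K" "y - x = l * (v - u)"
    using subfield_set_closed(7)[OF K] by (auto simp: algebra_simps)
  then show ?thesis
    by (rule that)
qed

text \<open>The sign \<open>e\<close> marks the directions that generate \<open>L\<close>-lines, so
  that one argument serves both alternatives. All differences in an \<open>L\<close>-line have the
  same character, whereas a \<open>K\<close>-line has differences of both characters: it is
  generated by two points of character \<open>- e\<close> and properly contains an
  \<open>L\<close>-line.\<close>

lemma two_line_classes:
  fixes f :: "'a::{field,finite} \<Rightarrow> 'a \<Rightarrow> 'a" and e :: int
  assumes Q: "quasigroup_on UNIV f" and idem: "\<And>x. f x x = x"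
    and L: "subfield_set L" and K: "subfield_set K" and "L \<subset> K"
    and Lsq: "\<forall>x\<in>L. is_square x" and z: "z \<in> K" "\<not> is_square z"
    and e: "e = 1 \<or> e = - 1"
    and hullL: "\<And>x y. quad_char (y - x) = e \<Longrightarrow> op_hull f {x, y} = affine_image (y - x) L x"
    and hullK: "\<And>x y. quad_char (y - x) = - e \<Longrightarrow> op_hull f {x, y} = affine_image (y - x) K x"
  shows "{S. two_generated f S \<and> \<not> trivial_subquasigroup f S \<and> \<not> minimal_subquasigroup f S}
      = {affine_image l K m | l m. l \<noteq> 0}"
    and "\<forall>s\<in>K. subquasigroup_generated_by f {0, s} K \<longleftrightarrow> quad_char s = - e"
    and "{S. minimal_subquasigroup f S} = {affine_image l L m | l m. quad_char l = e}"
proof -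
  have card_L_K: "card L < card K"
    using \<open>L \<subset> K\<close> by (simp add: psubset_card_mono)
  have in_line: "m \<in> affine_image l M m" "k \<in> M \<Longrightarrow> l * k + m \<in> affine_image l M m"
    if "subfield_set M" for l m k M
    using subfield_set_closed(1)[OF that] by (force simp: affine_image_def)+
  have char_cases: "quad_char x = e \<or> quad_char x = - e" if "x \<noteq> 0" for x :: 'a
    using that e by (auto simp: quad_char_def)
  \<comment> \<open>Both 1 and the nonsquare \<open>z\<close> lie in \<open>K\<close>, so either
    sign occurs among the multiples of \<open>l\<close> by nonzero elements of
    \<open>K\<close>.\<close>
  have adjust: "\<exists>k\<in>K. k \<noteq> 0 \<and> quad_char (l * k) = c"
    if "l \<noteq> 0" "c = 1 \<or> c = - 1" for l c
  proof (cases "quad_char l = c")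
    case True
    then show ?thesis
      using subfield_set_closed(2)[OF K] by (intro bexI[of _ 1]) auto
  next
    case False
    then have "quad_char (l * z) = c" "z \<noteq> 0"
      using that z(2) unfolding quad_char_mult by (auto simp: quad_char_def split: if_splits)
    then show ?thesis
      using z(1) by blast
  qed
  have minimal_L: "minimal_subquasigroup f (affine_image l L m)" if l: "quad_char l = e" for l m
    unfolding minimal_subquasigroup_iff[OF Q]
  proof (intro conjI ballI impI)
    have "l \<noteq> 0"
      using l e by (auto simp: quad_char_def)
    then have "m \<noteq> l * 1 + m"
      by simp
    then show "\<exists>x\<in>affine_image l L m. \<exists>y\<in>affine_image l L m. x \<noteq> y"
      using in_line[OF L] subfield_set_closed(2)[OF L] by blast
  next
    fix x y assume xy: "x \<in> affine_image l L m" "y \<in> affine_image l L m" "x \<noteq> y"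
    then obtain k where k: "k \<in> L" "y - x = l * k"
      using affine_image_diff[OF L] by metis
    then have "quad_char k = 1"
      using Lsq xy(3) by (auto simp: quad_char_eq_1_iff)
    then have "quad_char (y - x) = e"
      using k l by (simp add: quad_char_mult)
    then show "op_hull f {x, y} = affine_image l L m"
      using hullL affine_image_rebase[OF L xy] by simp
  qed
  have not_minimal_K: "\<not> minimal_subquasigroup f (affine_image l K m)" if l: "l \<noteq> 0" for l m
  proof
    assume min: "minimal_subquasigroup f (affine_image l K m)"
    obtain k where k: "k \<in> K" "k \<noteq> 0" "quad_char (l * k) = e"
      using adjust[OF l e] by blast
    then have "op_hull f {m, l * k + m} = affine_image l K m"
      using min in_line[OF K] \<open>l \<noteq> 0\<close> unfolding minimal_subquasigroup_iff[OF Q] by auto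
    moreover have "op_hull f {m, l * k + m} = affine_image (l * k) L m"
      using hullL[of "l * k + m" m] k(3) by simp
    \<comment> \<open>The same set would be an \<open>L\<close>-line and a \<open>K\<close>-line,
      which have different sizes.\<close>
    ultimately have "card (affine_image (l * k) L m) = card (affine_image l K m)"
      by simp
    then show False
      using card_L_K l k(2) by (simp add: card_affine_image)
  qed
  have hull_K: "\<exists>x y. x \<noteq> y \<and> affine_image l K m = op_hull f {x, y}" if l: "l \<noteq> 0" for l m
  proof -
    obtain k where k: "k \<in> K" "k \<noteq> 0" "quad_char (l * k) = - e"
      using adjust[OF l, of "- e"] e by auto
    have "op_hull f {m, l * k + m} = affine_image (l * k + m - m) K m"
      using hullK[of "l * k + m" m] k(3) by simp
    also have "\<dots> = affine_image l K m"
      using k l in_line[OF K] by (intro affine_image_rebase[OF K]) auto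
    finally show ?thesis
      using k(2) l by (intro exI[of _ m] exI[of _ "l * k + m"]) auto
  qed

  have "S \<in> {affine_image l K m | l m. l \<noteq> 0}"
    if S: "two_generated f S" "\<not> trivial_subquasigroup f S" "\<not> minimal_subquasigroup f S" for S
  proof -
    obtain x y where xy: "x \<noteq> y" "S = op_hull f {x, y}"
      using S nontrivial_two_generated_iff[of f S, OF Q idem] by blast
    then have "quad_char (y - x) = - e"
      using S(3) hullL[of y x] minimal_L char_cases[of "y - x"] by auto
    then have "S = affine_image (y - x) K x"
      using hullK xy by simp
    then show ?thesis
      using xy(1) by auto
  qed
  moreover have "two_generated f S \<and> \<not> trivial_subquasigroup f S \<and> \<not> minimal_subquasigroup f S"
    if "S \<in> {affine_image l K m | l m. l \<noteq> 0}" for S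
    using that hull_K not_minimal_K nontrivial_two_generated_iff[of f S, OF Q idem] by auto
  ultimately show "{S. two_generated f S \<and> \<not> trivial_subquasigroup f S
      \<and> \<not> minimal_subquasigroup f S} = {affine_image l K m | l m. l \<noteq> 0}"
    by blast

  show "\<forall>s\<in>K. subquasigroup_generated_by f {0, s} K \<longleftrightarrow> quad_char s = - e"
    unfolding subquasigroup_generated_by_iff[OF Q]
  proof
    fix s assume "s \<in> K"
    consider "s = 0" | "s \<noteq> 0" "quad_char s = e" | "s \<noteq> 0" "quad_char s = - e"
      using char_cases by blast
    then show "K = op_hull f {0, s} \<longleftrightarrow> quad_char s = - e"
    proof cases
      case 1
      have "op_hull f {0} \<subseteq> {0}"
        by (intro op_hull_least) (auto simp: op_closed_def idem)
      then have "K \<noteq> op_hull f {0, s}"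
        using 1 subfield_set_closed(2)[OF K] by auto
      moreover have "quad_char s \<noteq> - e"
        using 1 e by (auto simp: quad_char_def)
      ultimately show ?thesis
        by blast
    next
      case 2
      then have "card (op_hull f {0, s}) \<noteq> card K"
        using hullL[of s 0] card_L_K by (simp add: card_affine_image)
      moreover have "quad_char s \<noteq> - e"
        using 2 e by auto
      ultimately show ?thesis
        by auto
    next
      case 3
      have K1: "K = affine_image 1 K 0"
        by (simp add: affine_image_def)
      have "affine_image (s - 0) K 0 = affine_image 1 K 0"
        using \<open>s \<in> K\<close> 3(1) subfield_set_closed(1)[OF K] K1
        by (intro affine_image_rebase[OF K]) auto
      then show ?thesis
        using hullK[of s 0] 3(2) K1 by simp
    qed
  qed

  have "S \<in> {affine_image l L m | l m. quad_char l = e}" if S: "minimal_subquasigroup f S" for S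
  proof -
    obtain x y where xy: "x \<noteq> y" "S = op_hull f {x, y}"
      using S unfolding minimal_subquasigroup_iff[OF Q] by metis
    then have "quad_char (y - x) = e"
      using S hullK[of y x] not_minimal_K char_cases[of "y - x"] by auto
    moreover from this have "S = affine_image (y - x) L x"
      using hullL xy by simp
    ultimately show ?thesis
      by blast
  qed
  then show "{S. minimal_subquasigroup f S} = {affine_image l L m | l m. quad_char l = e}"
    using minimal_L by blast
qed

text \<open>If \<open>A\<close> and \<open>B\<close> consist of squares, all differences within one
  line have the same character. In either case any two points of a line generate a line over the
  same field, which is the line itself.\<close>

lemma single_line_class_minimal:
  fixes f :: "'a::{field,finite} \<Rightarrow> 'a \<Rightarrow> 'a"
  assumes Q: "quasigroup_on UNIV f"
    and A: "subfield_set A" and B: "subfield_set B"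
    and hull: "\<And>x y. x \<noteq> y \<Longrightarrow>
      op_hull f {x, y} = affine_image (y - x) (if is_square (y - x) then A else B) x"
    and sq: "A = B \<or> (\<forall>x\<in>A \<union> B. is_square x)" and "x \<noteq> y"
  shows "minimal_subquasigroup f (op_hull f {x, y})"
  unfolding minimal_subquasigroup_iff[OF Q]
proof (intro conjI ballI impI)
  show "\<exists>u\<in>op_hull f {x, y}. \<exists>v\<in>op_hull f {x, y}. u \<noteq> v"
    using op_hull_superset[of "{x, y}" f] \<open>x \<noteq> y\<close> by blast
next
  fix u v assume uv: "u \<in> op_hull f {x, y}" "v \<in> op_hull f {x, y}" "u \<noteq> v"
  define M where "M = (if is_square (y - x) then A else B)"
  have M: "subfield_set M"
    using A B by (simp add: M_def)
  have line: "op_hull f {x, y} = affine_image (y - x) M x"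
    using hull[OF \<open>x \<noteq> y\<close>] by (simp add: M_def)
  obtain k where k: "k \<in> M" "v - u = (y - x) * k"
    using affine_image_diff[OF M] uv(1,2) line by metis
  have "A = B \<or> (is_square (v - u) \<longleftrightarrow> is_square (y - x))"
  proof (cases "A = B")
    case False
    then have "is_square k"
      using sq k(1) by (auto simp: M_def split: if_splits)
    moreover have "k \<noteq> 0" "y - x \<noteq> 0"
      using k(2) \<open>u \<noteq> v\<close> by auto
    ultimately show ?thesis
      using k(2) is_square_mult_iff by metis
  qed simp
  then have "op_hull f {u, v} = affine_image (v - u) M u"
    using hull[OF uv(3)] by (auto simp: M_def)
  then show "op_hull f {u, v} = op_hull f {x, y}"
    using affine_image_rebase[OF M] uv line by simp
qed

section \<open>Classification when some 2-generated subquasigroup is neither trivial nor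
  minimal\<close>

theorem theorem5p5:
  fixes a b :: "'a::finite_field" and K K0 K1 :: "'a set"
  defines "K \<equiv> subfield_generated {a, b}"
    and "K0 \<equiv> subfield_generated {a}"
    and "K1 \<equiv> subfield_generated {b}"
  assumes "odd CARD('a)"
    and "is_quadratic_quasigroup a b"
    and "\<not> is_netto_quasigroup a b"
    and "\<exists>S. two_generated (quad_op a b) S \<and>
             \<not> trivial_subquasigroup (quad_op a b) S \<and> \<not> minimal_subquasigroup (quad_op a b) S"
  shows "{S. two_generated (quad_op a b) S \<and>
             \<not> trivial_subquasigroup (quad_op a b) S \<and> \<not> minimal_subquasigroup (quad_op a b) S}
           = {affine_image l K m | l m. l \<noteq> 0} \<and>
         is_square (- 1 :: 'a) \<and> is_square a \<and> is_square b \<and> is_square (1 - a) \<and> is_square (1 - b) \<and>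
         (((\<forall>x\<in>K1. x \<noteq> 0 \<longrightarrow> is_square x) \<and> (\<exists>x\<in>K0. \<not> is_square x) \<and>
           (\<forall>s\<in>K. subquasigroup_generated_by (quad_op a b) {0, s} K \<longleftrightarrow> quad_char s = 1) \<and>
           subquasigroup_generated_by (quad_op a b) {0, 1} K \<and>
           {S. minimal_subquasigroup (quad_op a b) S}
             = {affine_image z K1 m | z m. quad_char z = - 1})
          \<or>
          ((\<forall>x\<in>K0. x \<noteq> 0 \<longrightarrow> is_square x) \<and> (\<exists>x\<in>K1. \<not> is_square x) \<and>
           (\<forall>z\<in>K. subquasigroup_generated_by (quad_op a b) {0, z} K \<longleftrightarrow> quad_char z = - 1) \<and>
           {S. minimal_subquasigroup (quad_op a b) S}
             = {affine_image s K0 m | s m. quad_char s = 1}))"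
proof -
  define f where "f = quad_op a b"
  \<comment> \<open>The sets generated by 0 and 1 in the quasigroup for \<open>a, b\<close> and in
    the one for \<open>b, a\<close>; they govern the square and the nonsquare directions
    respectively.\<close>
  define A where "A = (if \<forall>x\<in>K0. is_square x then K0 else K)"
  define B where "B = (if \<forall>x\<in>K1. is_square x then K1 else K)"
  note ab = \<open>is_quadratic_quasigroup a b\<close>[unfolded is_quadratic_quasigroup_iff]
  have "is_quadratic_quasigroup b a" "\<not> is_netto_quasigroup b a"
    using assms(5,6)
    by (auto simp: is_netto_quasigroup_def is_quadratic_quasigroup_def add.commute mult.commute)
  then have hull01: "op_hull (quad_op a b) {0, 1} = A" "op_hull (quad_op b a) {0, 1} = B"
    using op_hull_eq_subfield_generated[of a b] op_hull_eq_subfield_generated[of b a] assms(5,6)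
    unfolding A_def B_def K_def K0_def K1_def by (simp_all add: insert_commute[of b a])
  have hull: "op_hull f {x, y} = affine_image (y - x) (if is_square (y - x) then A else B) x"
    if "x \<noteq> y" for x y
    using op_hull_quad_op[OF that, of a b] hull01 by (auto simp: f_def)
  obtain S where S: "two_generated f S" "\<not> trivial_subquasigroup f S"
    "\<not> minimal_subquasigroup f S"
    using assms(7) unfolding f_def by blast
  \<comment> \<open>The quasigroup property is part of \<open>subquasigroup\<close>, so it can be
    read off from \<open>S\<close>.\<close>
  then have Q: "quasigroup_on UNIV f"
    unfolding two_generated_def subquasigroup_generated_by_def subquasigroup_def by blast
  have idem: "f x x = x" for x
    by (simp add: f_def quad_op_eq)
  have K: "subfield_set K" and K0: "subfield_set K0" and K1: "subfield_set K1"
    unfolding K_def K0_def K1_def by (rule subfield_set_subfield_generated)+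
  have "{a, b} \<subseteq> K" and aK0: "a \<in> K0" and bK1: "b \<in> K1"
    unfolding K_def K0_def K1_def using subfield_generated_superset by blast+
  then have K01: "K0 \<subseteq> K" "K1 \<subseteq> K"
    using subfield_generated_least[OF K, of "{a}"] subfield_generated_least[OF K, of "{b}"]
    unfolding K0_def K1_def by auto
  have "\<not> (A = B \<or> (\<forall>x\<in>A \<union> B. is_square x))"
  proof
    assume sq: "A = B \<or> (\<forall>x\<in>A \<union> B. is_square x)"
    obtain x y where "x \<noteq> y" "S = op_hull f {x, y}"
      using S nontrivial_two_generated_iff[of f S, OF Q idem] by blast
    moreover have "subfield_set A" "subfield_set B"
      using K K0 K1 by (auto simp: A_def B_def)
    ultimately show False
      using S(3) single_line_class_minimal[OF Q _ _ hull sq] by blast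
  qed
  \<comment> \<open>If both \<open>K0\<close> and \<open>K1\<close> contain nonsquares, then
    \<open>A = B = K\<close>; if neither does, \<open>A\<close> and \<open>B\<close> consist of
    squares. Only the mixed cases survive.\<close>
  then consider (i) "\<forall>x\<in>K1. is_square x" "\<exists>x\<in>K0. \<not> is_square x"
    | (ii) "\<forall>x\<in>K0. is_square x" "\<exists>x\<in>K1. \<not> is_square x"
    unfolding A_def B_def
    by (cases "\<forall>x\<in>K0. is_square x"; cases "\<forall>x\<in>K1. is_square x") auto
  then show ?thesis
  proof cases
    case i
    then have AB: "A = K" "B = K1"
      by (auto simp: A_def B_def)
    have "K1 \<subset> K"
      using i K01 by blast
    obtain z where z: "z \<in> K" "\<not> is_square z"
      using i(2) K01 by blast
    have lines_K1: "op_hull f {x, y} = affine_image (y - x) K1 x"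
      if "quad_char (y - x) = - 1" for x y
      using hull[of x y] that AB by (cases "x = y") (auto simp: quad_char_def split: if_splits)
    have lines_K: "op_hull f {x, y} = affine_image (y - x) K x"
      if "quad_char (y - x) = - (- 1)" for x y
      using hull[of x y] that AB by (cases "x = y") (auto simp: quad_char_def split: if_splits)
    \<comment> \<open>The small lines are those over \<open>K1\<close>, in nonsquare directions;
      hence \<open>e = - 1\<close>.\<close>
    note lines = two_line_classes[where e = "- 1", OF Q idem K1 K \<open>K1 \<subset> K\<close> i(1) z
        disjI2[OF refl] lines_K1 lines_K, unfolded f_def minus_minus]
    \<comment> \<open>These elements are squares as members of \<open>K1\<close>; \<open>a\<close>
      and \<open>1 - a\<close> follow since they have the same character as \<open>b\<close> and
      \<open>1 - b\<close>.\<close>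
    have "- 1 \<in> K1" "1 - b \<in> K1"
      using bK1 by (auto intro!: subfield_set_closed(2,5,7)[OF K1])
    then have "is_square (- 1 :: 'a)" "is_square b" "is_square (1 - b)"
      using i(1) bK1 by blast+
    moreover have "subquasigroup_generated_by f {0, 1} K"
      using AB hull01(1) by (simp add: subquasigroup_generated_by_iff[OF Q] flip: f_def)
    ultimately show ?thesis
      using i ab unfolding f_def by (intro conjI disjI1 lines) auto
  next
    case ii
    then have AB: "A = K0" "B = K"
      by (auto simp: A_def B_def)
    have "K0 \<subset> K"
      using ii K01 by blast
    obtain z where z: "z \<in> K" "\<not> is_square z"
      using ii(2) K01 by blast
    have lines_K0: "op_hull f {x, y} = affine_image (y - x) K0 x"
      if "quad_char (y - x) = 1" for x y
      using hull[of x y] that AB by (cases "x = y") (auto simp: quad_char_def split: if_splits)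
    have lines_K: "op_hull f {x, y} = affine_image (y - x) K x"
      if "quad_char (y - x) = - 1" for x y
      using hull[of x y] that AB by (cases "x = y") (auto simp: quad_char_def split: if_splits)
    \<comment> \<open>Here the small lines are those over \<open>K0\<close>, in square
      directions.\<close>
    note lines = two_line_classes[where e = 1, OF Q idem K0 K \<open>K0 \<subset> K\<close> ii(1) z
        disjI1[OF refl] lines_K0 lines_K, unfolded f_def minus_minus]
    have "- 1 \<in> K0" "1 - a \<in> K0"
      using aK0 by (auto intro!: subfield_set_closed(2,5,7)[OF K0])
    then have "is_square (- 1 :: 'a)" "is_square a" "is_square (1 - a)"
      using ii(1) aK0 by blast+
    then show ?thesis
      using ii ab unfolding f_def by (intro conjI disjI2 lines) auto
  qed
qed

end
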